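(* Let $n\ge1$ and $s\in\{0,1,\ldots,n-1\}$. Generically, at each local minimizer $\bar x\in\mathbb{R}^{n,s}$ of SCNO the sparsity constraint is active, i.e. $\|\bar x\|_0=s$. That is, the set of all $f\in C^2(\mathbb{R}^n,\mathbb{R})$ such that every local minimizer $\bar x$ of $f$ on $\mathbb{R}^{n,s}$ satisfies $\|\bar x\|_0=s$ is $C^2_s$-generic.
   Context: For $x\in\mathbb{R}^n$, $\|x\|_0$ is the number of non-zero entries of $x$, and $\mathbb{R}^{n,s}=\{x\in\mathbb{R}^n : \|x\|_0\le s\}$. SCNO is the problem $\min f(x)$ s.t. $x\in\mathbb{R}^{n,s}$. The $C^2_s$-topology is the strong (Whitney) $C^2$-topology on $C^2(\mathbb{R}^n,\mathbb{R})$: a neighborhood base of $f$ consists of the sets of all $g$ such that the function value, all first-order and all second-order partial derivatives of $g-f$ at $x$ are bounded in absolute value by $\varepsilon(x)$ for every $x\in\mathbb{R}^n$ (strict inequality), where $\varepsilon:\mathbb{R}^n\to(0,\infty)$ ranges over continuous positive functions. A subset of $C^2(\mathbb{R}^n,\mathbb{R})$ is $C^2_s$-generic if it contains a countable intersection of $C^2_s$-open and $C^2_s$-dense subsets. *)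

theory Defs
  imports "HOL-Analysis.Analysis"
begin

definition zero_norm :: "real ^ 'n \<Rightarrow> nat" where
  "zero_norm x = card {i. x $ i \<noteq> 0}"

definition sparse_vectors :: "nat \<Rightarrow> (real ^ 'n) set" where
  "sparse_vectors s = {x. zero_norm x \<le> s}"

definition local_minimizer_on :: "('a::metric_space \<Rightarrow> real) \<Rightarrow> 'a set \<Rightarrow> 'a \<Rightarrow> bool" where
  "local_minimizer_on f M x \<longleftrightarrow> x \<in> M \<and> (\<exists>r>0. \<forall>y\<in>M \<inter> ball x r. f x \<le> f y)"

definition partial_deriv :: "'n \<Rightarrow> (real ^ 'n \<Rightarrow> real) \<Rightarrow> real ^ 'n \<Rightarrow> real" where
  "partial_deriv i f x = deriv (\<lambda>t. f (x + t *\<^sub>R axis i 1)) 0"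

lemma partial_deriv_frechet:
  assumes "(f has_derivative f') (at x)"
  shows "partial_deriv i f x = f' (axis i 1)"
proof -
  have "((\<lambda>t. f (x + t *\<^sub>R axis i 1)) has_derivative (\<lambda>t. f' (t *\<^sub>R axis i 1))) (at 0)"
  proof (rule has_derivative_compose[where f = "\<lambda>t. x + t *\<^sub>R axis i 1"])
    show "((\<lambda>t. x + t *\<^sub>R axis i 1) has_derivative (\<lambda>t. t *\<^sub>R axis i 1)) (at 0)"
      by (auto intro!: derivative_eq_intros)
    show "(f has_derivative f') (at (x + 0 *\<^sub>R axis i 1))"
      using assms by simp
  qed
  moreover have "(\<lambda>t. f' (t *\<^sub>R axis i 1)) = (*) (f' (axis i 1))"
    using has_derivative_linear[OF assms] by (auto simp: linear_cmul)
  ultimately show ?thesis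
    unfolding partial_deriv_def has_field_derivative_def[symmetric]
    by (intro DERIV_imp_deriv) (simp add: has_field_derivative_def)
qed

(* The usual recursion: a function is of class C^(k+1) iff it is (totally) differentiable
   and all its first-order partial derivatives are of class C^k. *)
definition C1_functions :: "(real ^ 'n \<Rightarrow> real) set" where
  "C1_functions = {f. (\<forall>x. f differentiable (at x)) \<and>
     (\<forall>i. continuous_on UNIV (partial_deriv i f))}"

definition C2_functions :: "(real ^ 'n \<Rightarrow> real) set" where
  "C2_functions = {f. (\<forall>x. f differentiable (at x)) \<and>
     (\<forall>i. partial_deriv i f \<in> C1_functions)}"

definition C2s_nbhd :: "(real ^ 'n \<Rightarrow> real) \<Rightarrow> (real ^ 'n \<Rightarrow> real) \<Rightarrow> (real ^ 'n \<Rightarrow> real) set" where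
  "C2s_nbhd f \<epsilon> = {g \<in> C2_functions. \<forall>x.
     \<bar>g x - f x\<bar> < \<epsilon> x \<and>
     (\<forall>i. \<bar>partial_deriv i (\<lambda>y. g y - f y) x\<bar> < \<epsilon> x) \<and>
     (\<forall>i j. \<bar>partial_deriv i (partial_deriv j (\<lambda>y. g y - f y)) x\<bar> < \<epsilon> x)}"

definition C2s_open :: "(real ^ 'n \<Rightarrow> real) set \<Rightarrow> bool" where
  "C2s_open U \<longleftrightarrow> U \<subseteq> C2_functions \<and>
     (\<forall>f\<in>U. \<exists>\<epsilon>. continuous_on UNIV \<epsilon> \<and> (\<forall>x. 0 < \<epsilon> x) \<and> C2s_nbhd f \<epsilon> \<subseteq> U)"

definition C2s_topology :: "(real ^ 'n \<Rightarrow> real) topology" where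
  "C2s_topology = topology C2s_open"

lemma istopology_C2s_open: "istopology C2s_open"
  unfolding istopology_def
proof safe
  fix S T :: "(real ^ 'n \<Rightarrow> real) set"
  assume S: "C2s_open S" and T: "C2s_open T"
  show "C2s_open (S \<inter> T)"
    unfolding C2s_open_def
  proof safe
    show "f \<in> C2_functions" if "f \<in> S" for f
      using S that by (auto simp: C2s_open_def)
    fix f assume "f \<in> S" "f \<in> T"
    then obtain d e where
      d: "continuous_on UNIV d" "\<forall>x. 0 < d x" "C2s_nbhd f d \<subseteq> S" and
      e: "continuous_on UNIV e" "\<forall>x. 0 < e x" "C2s_nbhd f e \<subseteq> T"
      using S T unfolding C2s_open_def by meson
    have "C2s_nbhd f (\<lambda>x. min (d x) (e x)) \<subseteq> C2s_nbhd f d \<inter> C2s_nbhd f e"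
      by (auto simp: C2s_nbhd_def)
    then show "\<exists>\<epsilon>. continuous_on UNIV \<epsilon> \<and> (\<forall>x. 0 < \<epsilon> x) \<and> C2s_nbhd f \<epsilon> \<subseteq> S \<inter> T"
      using d e by (intro exI[of _ "\<lambda>x. min (d x) (e x)"]) (auto intro: continuous_on_min)
  qed
next
  fix K :: "(real ^ 'n \<Rightarrow> real) set set"
  assume "\<forall>S\<in>K. C2s_open S"
  then show "C2s_open (\<Union>K)"
    unfolding C2s_open_def by (meson Sup_least UnionE Union_upper order_trans)
qed

lemma openin_C2s_topology [simp]: "openin C2s_topology U \<longleftrightarrow> C2s_open U"
  unfolding C2s_topology_def by (simp add: topology_inverse' istopology_C2s_open)

lemma topspace_C2s_topology [simp]: "topspace C2s_topology = C2_functions"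
proof -
  have "openin C2s_topology C2_functions"
    unfolding openin_C2s_topology C2s_open_def C2s_nbhd_def
    by (auto intro!: exI[of _ "\<lambda>_. 1"])
  moreover have "topspace C2s_topology \<subseteq> C2_functions"
    using openin_topspace[of C2s_topology]
    unfolding openin_C2s_topology C2s_open_def by blast
  ultimately show ?thesis
    by (blast dest: openin_subset)
qed

lemma partial_deriv_diff:
  assumes "\<And>x. f differentiable (at x)" "\<And>x. g differentiable (at x)"
  shows "partial_deriv i (\<lambda>y. g y - f y) = (\<lambda>x. partial_deriv i g x - partial_deriv i f x)"
proof
  fix x
  obtain f' g' where "(f has_derivative f') (at x)" "(g has_derivative g') (at x)"
    using assms unfolding differentiable_def by meson
  then show "partial_deriv i (\<lambda>y. g y - f y) x = partial_deriv i g x - partial_deriv i f x"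
    by (simp add: partial_deriv_frechet partial_deriv_frechet[OF has_derivative_diff])
qed

lemma partial_deriv_diff_C2:
  assumes "f \<in> C2_functions" "g \<in> C2_functions"
  shows "partial_deriv i (\<lambda>y. g y - f y) = (\<lambda>x. partial_deriv i g x - partial_deriv i f x)"
    and "partial_deriv j (partial_deriv i (\<lambda>y. g y - f y)) =
           (\<lambda>x. partial_deriv j (partial_deriv i g) x - partial_deriv j (partial_deriv i f) x)"
  using assms by (auto simp: partial_deriv_diff C2_functions_def C1_functions_def)

lemma C2_functions_continuous:
  assumes "f \<in> C2_functions"
  shows "continuous_on UNIV f" "continuous_on UNIV (partial_deriv i f)"
    "continuous_on UNIV (partial_deriv j (partial_deriv i f))"
  using assms
  by (auto simp: C2_functions_def C1_functions_def continuous_at_imp_continuous_on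
      differentiable_imp_continuous_within)

lemma continuous_on_Max_finite:
  fixes h :: "'k \<Rightarrow> 'a::topological_space \<Rightarrow> real"
  assumes "finite I" "I \<noteq> {}" "\<And>k. k \<in> I \<Longrightarrow> continuous_on UNIV (h k)"
  shows "continuous_on UNIV (\<lambda>x. Max ((\<lambda>k. h k x) ` I))"
  using assms
proof (induction I rule: finite_ne_induct)
  case (insert k I)
  have "(\<lambda>x. Max ((\<lambda>k. h k x) ` insert k I)) = (\<lambda>x. max (h k x) (Max ((\<lambda>k. h k x) ` I)))"
    using insert by (auto simp: fun_eq_iff)
  then show ?case
    using insert by (auto intro!: continuous_on_max)
qed auto

(* Together with centre_in_C2s_nbhd: the sets C2s_nbhd f \<epsilon>, for positive continuous \<epsilon>,
   form an open neighbourhood base of f in C2s_topology. *)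
lemma C2s_open_nbhd:
  fixes f :: "real ^ 'n \<Rightarrow> real"
  assumes f: "f \<in> C2_functions" and cont: "continuous_on UNIV \<epsilon>"
  shows "C2s_open (C2s_nbhd f \<epsilon>)"
  unfolding C2s_open_def
proof safe
  fix g assume g: "g \<in> C2s_nbhd f \<epsilon>"
  then show gC: "g \<in> C2_functions" by (simp add: C2s_nbhd_def)
  define D where "D = (\<lambda>g :: real ^ 'n \<Rightarrow> real. insert g (range (\<lambda>i. partial_deriv i g) \<union>
      range (\<lambda>(i, j). partial_deriv i (partial_deriv j g))))"
  define m where "m = (\<lambda>x. Max ((\<lambda>u. \<bar>u x\<bar>) ` D (\<lambda>y. g y - f y)))"
  have fin: "finite (D h)" "D h \<noteq> {}" for h by (auto simp: D_def)
  have "continuous_on UNIV (\<lambda>x. \<bar>u x\<bar>)" if "u \<in> D (\<lambda>y. g y - f y)" for u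
  proof -
    note cont = C2_functions_continuous[OF f] C2_functions_continuous[OF gC]
    from that consider "u = (\<lambda>y. g y - f y)" | i where "u = partial_deriv i (\<lambda>y. g y - f y)"
      | i j where "u = partial_deriv i (partial_deriv j (\<lambda>y. g y - f y))"
      unfolding D_def by auto
    then have "continuous_on UNIV u"
    proof cases
      case 3
      then show ?thesis
        by (simp only: partial_deriv_diff_C2(2)[OF f gC]) (intro continuous_on_diff cont)
    qed (simp_all only: partial_deriv_diff_C2(1)[OF f gC] cont continuous_on_diff)
    then show ?thesis by (intro continuous_intros)
  qed
  then have cm: "continuous_on UNIV m"
    unfolding m_def using fin by (intro continuous_on_Max_finite) auto
  have lt: "m x < \<epsilon> x" for x
    using g fin unfolding m_def by (auto simp: C2s_nbhd_def D_def)
  have bd: "\<bar>u x\<bar> \<le> m x" if "u \<in> D (\<lambda>y. g y - f y)" for u x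
    unfolding m_def using that fin by auto
  have "C2s_nbhd g (\<lambda>x. \<epsilon> x - m x) \<subseteq> C2s_nbhd f \<epsilon>"
  proof
    fix h assume h: "h \<in> C2s_nbhd g (\<lambda>x. \<epsilon> x - m x)"
    then have hC: "h \<in> C2_functions" by (simp add: C2s_nbhd_def)
    have "\<bar>h x - f x\<bar> < \<epsilon> x" for x
    proof -
      have "\<bar>h x - g x\<bar> < \<epsilon> x - m x"
        using h by (simp add: C2s_nbhd_def)
      moreover have "\<bar>g x - f x\<bar> \<le> m x"
        using bd[of "\<lambda>y. g y - f y" x] by (simp add: D_def)
      ultimately show ?thesis by linarith
    qed
    moreover have "\<bar>partial_deriv i (\<lambda>y. h y - f y) x\<bar> < \<epsilon> x" for i x
    proof -
      have "\<bar>partial_deriv i (\<lambda>y. h y - g y) x\<bar> < \<epsilon> x - m x"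
        using h by (simp add: C2s_nbhd_def)
      moreover have "\<bar>partial_deriv i (\<lambda>y. g y - f y) x\<bar> \<le> m x"
        by (rule bd) (auto simp: D_def)
      ultimately show ?thesis
        by (simp only: partial_deriv_diff_C2(1)[OF f hC] partial_deriv_diff_C2(1)[OF f gC]
            partial_deriv_diff_C2(1)[OF gC hC])
    qed
    moreover have "\<bar>partial_deriv i (partial_deriv j (\<lambda>y. h y - f y)) x\<bar> < \<epsilon> x" for i j x
    proof -
      have "\<bar>partial_deriv i (partial_deriv j (\<lambda>y. h y - g y)) x\<bar> < \<epsilon> x - m x"
        using h by (simp add: C2s_nbhd_def)
      moreover have "\<bar>partial_deriv i (partial_deriv j (\<lambda>y. g y - f y)) x\<bar> \<le> m x"
        by (rule bd) (auto simp: D_def)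
      ultimately show ?thesis
        by (simp only: partial_deriv_diff_C2(2)[OF f hC] partial_deriv_diff_C2(2)[OF f gC]
            partial_deriv_diff_C2(2)[OF gC hC])
    qed
    ultimately show "h \<in> C2s_nbhd f \<epsilon>"
      using hC by (simp add: C2s_nbhd_def)
  qed
  then show "\<exists>\<delta>. continuous_on UNIV \<delta> \<and> (\<forall>x. 0 < \<delta> x) \<and> C2s_nbhd g \<delta> \<subseteq> C2s_nbhd f \<epsilon>"
    using cm cont lt by (intro exI[of _ "\<lambda>x. \<epsilon> x - m x"]) (auto intro!: continuous_intros)
qed

lemma centre_in_C2s_nbhd:
  fixes f :: "real ^ 'n \<Rightarrow> real"
  assumes "f \<in> C2_functions" "\<And>x. 0 < \<epsilon> x"
  shows "f \<in> C2s_nbhd f \<epsilon>"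
proof -
  have "partial_deriv i (\<lambda>y. 0) = (\<lambda>x. 0)" for i :: 'n
    by (simp add: partial_deriv_def fun_eq_iff)
  then show ?thesis
    using assms by (simp add: C2s_nbhd_def)
qed

(* A sequence of sets may repeat, so this covers all nonempty countable families
   (and the empty one, via the constant sequence of the whole space). *)
definition C2s_generic :: "(real ^ 'n \<Rightarrow> real) set \<Rightarrow> bool" where
  "C2s_generic S \<longleftrightarrow> S \<subseteq> C2_functions \<and>
     (\<exists>U :: nat \<Rightarrow> (real ^ 'n \<Rightarrow> real) set.
        (\<forall>k. openin C2s_topology (U k) \<and>
             C2s_topology closure_of (U k) = topspace C2s_topology) \<and>
        (\<Inter>k. U k) \<subseteq> S)"

end

theory Submission
  imports Defs
begin

text \<open>If a local minimizer \<open>x\<close> has fewer than \<open>s\<close> non-zero entries, it may be moved along every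
coordinate axis without leaving the feasible set, so \<open>x\<close> is an unconstrained critical point of
\<open>f\<close>, and, as \<open>s < n\<close>, it lies in the union \<open>K\<close> of the coordinate hyperplanes. Having no critical
point in the compact set \<open>K \<inter> cball 0 m\<close> is an open condition. It is also a dense one: \<open>K\<close> is
negligible, hence so is its image under the \<open>C\<^sup>1\<close> map \<open>-\<nabla>f\<close>, and adding to \<open>f\<close> a cut-off linear
form with small coefficient vector \<open>c\<close> outside this image removes all critical points there.\<close>

subsection \<open>Calculus of \<open>C\<^sup>2\<close> functions\<close>

lemma partial_deriv_add:
  assumes "f differentiable (at x)" "g differentiable (at x)"
  shows "partial_deriv i (\<lambda>y. f y + g y) x = partial_deriv i f x + partial_deriv i g x"
proof -
  obtain f' g' where "(f has_derivative f') (at x)" "(g has_derivative g') (at x)"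
    using assms unfolding differentiable_def by meson
  then show ?thesis
    by (simp add: partial_deriv_frechet partial_deriv_frechet[OF has_derivative_add])
qed

lemma partial_deriv_mult:
  assumes "f differentiable (at x)" "g differentiable (at x)"
  shows "partial_deriv i (\<lambda>y. f y * g y) x = f x * partial_deriv i g x + partial_deriv i f x * g x"
proof -
  obtain f' g' where "(f has_derivative f') (at x)" "(g has_derivative g') (at x)"
    using assms unfolding differentiable_def by meson
  then show ?thesis
    by (simp add: partial_deriv_frechet partial_deriv_frechet[OF has_derivative_mult])
qed

lemma partial_deriv_compose:
  assumes "f differentiable (at x)" "(h has_real_derivative h') (at (f x))"
  shows "partial_deriv i (\<lambda>y. h (f y)) x = h' * partial_deriv i f x"
proof -
  obtain f' where "(f has_derivative f') (at x)"
    using assms unfolding differentiable_def by meson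
  then show ?thesis
    using partial_deriv_frechet[OF has_derivative_compose] assms(2)
    by (simp add: partial_deriv_frechet has_field_derivative_def)
qed

lemma partial_deriv_const [simp]: "partial_deriv i (\<lambda>x. c) = (\<lambda>x. 0)"
  by (simp add: partial_deriv_def fun_eq_iff)

lemma partial_deriv_nth: "partial_deriv i (\<lambda>x. x $ k) = (\<lambda>x. if i = k then 1 else 0)"
  by (auto simp: fun_eq_iff axis_def
      partial_deriv_frechet[OF bounded_linear_imp_has_derivative[OF bounded_linear_vec_nth]])

text \<open>Derivatives are local. This serves to discard the cut-off factor where it equals 1 and
  to show that derivatives vanish off the support.\<close>

lemma partial_deriv_cong_open:
  assumes "open S" "x \<in> S" "\<And>y. y \<in> S \<Longrightarrow> f y = g y" "f differentiable (at x)"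
  shows "partial_deriv i g x = partial_deriv i f x"
proof -
  obtain f' where f': "(f has_derivative f') (at x)"
    using assms unfolding differentiable_def by meson
  then have "(g has_derivative f') (at x)"
    by (rule has_derivative_transform_within_open[of _ _ _ _ S]) (use assms in auto)
  with f' show ?thesis
    by (simp add: partial_deriv_frechet)
qed

lemma partial_deriv_eq_0_open:
  assumes "open S" "x \<in> S" "\<And>y. y \<in> S \<Longrightarrow> f y = 0"
  shows "partial_deriv i f x = 0"
  using partial_deriv_cong_open[of S x "\<lambda>_. 0" f i] assms by simp

section \<open>Closure properties of the classes C1 and C2\<close>

lemma C1_functions_differentiable: "f \<in> C1_functions \<Longrightarrow> f differentiable (at x)"
  and C2_functions_differentiable: "f \<in> C2_functions \<Longrightarrow> f differentiable (at x)"
  and C2_functions_partial_deriv: "f \<in> C2_functions \<Longrightarrow> partial_deriv i f \<in> C1_functions"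
  by (auto simp: C1_functions_def C2_functions_def)

lemma differentiable_continuous_on_UNIV:
  "(\<And>x. f differentiable (at x)) \<Longrightarrow> continuous_on UNIV f"
  by (simp add: continuous_at_imp_continuous_on differentiable_imp_continuous_within)

text \<open>The recursive definition of C2 does not state continuity of the first partials; it
  follows from their differentiability.\<close>

lemma C2_functions_subset_C1: "f \<in> C2_functions \<Longrightarrow> f \<in> C1_functions"
  by (auto simp: C1_functions_def C2_functions_def intro: differentiable_continuous_on_UNIV)

lemma C1_functions_add:
  assumes "f \<in> C1_functions" "g \<in> C1_functions"
  shows "(\<lambda>x. f x + g x) \<in> C1_functions"
proof -
  note d = assms[THEN C1_functions_differentiable]
  have "partial_deriv i (\<lambda>x. f x + g x) = (\<lambda>x. partial_deriv i f x + partial_deriv i g x)" for i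
    using d by (simp add: fun_eq_iff partial_deriv_add)
  with d assms show ?thesis
    by (auto simp: C1_functions_def intro!: continuous_on_add)
qed

lemma C1_functions_mult:
  assumes "f \<in> C1_functions" "g \<in> C1_functions"
  shows "(\<lambda>x. f x * g x) \<in> C1_functions"
proof -
  note d = assms[THEN C1_functions_differentiable]
  have "partial_deriv i (\<lambda>x. f x * g x) =
      (\<lambda>x. f x * partial_deriv i g x + partial_deriv i f x * g x)" for i
    using d by (simp add: fun_eq_iff partial_deriv_mult)
  moreover have "continuous_on UNIV f" "continuous_on UNIV g"
    using d by (simp_all add: differentiable_continuous_on_UNIV)
  ultimately show ?thesis
    using d assms by (auto simp: C1_functions_def intro!: continuous_on_add continuous_on_mult)
qed

lemma differentiable_real_compose:
  assumes "f differentiable (at x)" "(h has_real_derivative h') (at (f x))"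
  shows "(\<lambda>y. h (f y)) differentiable (at x)"
  using assms unfolding differentiable_def has_field_derivative_def
  by (blast intro: has_derivative_compose)

lemma C1_functions_compose:
  assumes f: "f \<in> C1_functions"
    and h: "\<And>t. (h has_real_derivative h' t) (at t)" and h': "continuous_on UNIV h'"
  shows "(\<lambda>x. h (f x)) \<in> C1_functions"
proof -
  note d = f[THEN C1_functions_differentiable]
  have "partial_deriv i (\<lambda>x. h (f x)) = (\<lambda>x. h' (f x) * partial_deriv i f x)" for i
    using d h by (simp add: fun_eq_iff partial_deriv_compose)
  moreover have "continuous_on UNIV (\<lambda>x. h' (f x))"
    using continuous_on_compose2[OF h' differentiable_continuous_on_UNIV[OF d]] by simp
  ultimately show ?thesis
    using f differentiable_real_compose[OF d h]
    by (auto simp: C1_functions_def intro!: continuous_on_mult)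
qed

lemma C2_functions_add:
  assumes "f \<in> C2_functions" "g \<in> C2_functions"
  shows "(\<lambda>x. f x + g x) \<in> C2_functions"
proof -
  note d = assms[THEN C2_functions_differentiable]
  have "partial_deriv i (\<lambda>x. f x + g x) = (\<lambda>x. partial_deriv i f x + partial_deriv i g x)" for i
    using d by (simp add: fun_eq_iff partial_deriv_add)
  with d assms show ?thesis
    by (auto simp: C2_functions_def intro!: C1_functions_add)
qed

lemma C2_functions_mult:
  assumes "f \<in> C2_functions" "g \<in> C2_functions"
  shows "(\<lambda>x. f x * g x) \<in> C2_functions"
proof -
  note d = assms[THEN C2_functions_differentiable]
  have "partial_deriv i (\<lambda>x. f x * g x) =
      (\<lambda>x. f x * partial_deriv i g x + partial_deriv i f x * g x)" for i
    using d by (simp add: fun_eq_iff partial_deriv_mult)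
  with d assms show ?thesis
    by (auto simp: C2_functions_def
        intro!: C1_functions_add C1_functions_mult C2_functions_subset_C1[OF assms(1)]
          C2_functions_subset_C1[OF assms(2)])
qed

text \<open>By the chain rule the partials are products of \<open>h' (f x)\<close> with partials of
  \<open>f\<close>. Both factors are C1, the first by the C1 version of the lemma applied to
  \<open>h'\<close>.\<close>

lemma C2_functions_compose:
  assumes f: "f \<in> C2_functions"
    and h: "\<And>t. (h has_real_derivative h' t) (at t)"
    and h': "\<And>t. (h' has_real_derivative h'' t) (at t)" and h'': "continuous_on UNIV h''"
  shows "(\<lambda>x. h (f x)) \<in> C2_functions"
proof -
  note d = f[THEN C2_functions_differentiable]
  have "partial_deriv i (\<lambda>x. h (f x)) = (\<lambda>x. h' (f x) * partial_deriv i f x)" for i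
    using d h by (simp add: fun_eq_iff partial_deriv_compose)
  moreover have "(\<lambda>x. h' (f x)) \<in> C1_functions"
    using C1_functions_compose[OF C2_functions_subset_C1[OF f] h' h''] .
  ultimately show ?thesis
    using f differentiable_real_compose[OF d h]
    by (auto simp: C2_functions_def intro!: C1_functions_mult)
qed

lemma C2_functions_const: "(\<lambda>x. c) \<in> C2_functions"
  by (simp add: C2_functions_def C1_functions_def)

lemma C2_functions_nth: "(\<lambda>x :: real ^ 'n. x $ k) \<in> C2_functions"
proof -
  have "(\<lambda>x :: real ^ 'n. x $ k) differentiable (at x)" for x
    by (rule differentiableI[OF bounded_linear_imp_has_derivative[OF bounded_linear_vec_nth]])
  then show ?thesis
    by (simp add: C2_functions_def C1_functions_def partial_deriv_nth)
qed

lemma C2_functions_sum: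
  assumes "\<And>k. k \<in> I \<Longrightarrow> f k \<in> C2_functions"
  shows "(\<lambda>x. \<Sum>k\<in>I. f k x) \<in> C2_functions"
  using assms
  by (induction I rule: infinite_finite_induct) (auto intro: C2_functions_const C2_functions_add)

lemma partial_deriv_lincomb:
  assumes "\<And>k x. k \<in> I \<Longrightarrow> w k differentiable (at x)"
  shows "partial_deriv i (\<lambda>x. \<Sum>k\<in>I. c k * w k x) = (\<lambda>x. \<Sum>k\<in>I. c k * partial_deriv i (w k) x)"
proof
  fix x
  obtain W where W: "\<And>k. k \<in> I \<Longrightarrow> (w k has_derivative W k) (at x)"
    using bchoice[of I "\<lambda>k W. (w k has_derivative W) (at x)"] assms
    unfolding differentiable_def by blast
  then have "((\<lambda>x. \<Sum>k\<in>I. c k * w k x) has_derivative (\<lambda>h. \<Sum>k\<in>I. c k * W k h)) (at x)"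
    by (intro has_derivative_sum has_derivative_mult_right)
  then show "partial_deriv i (\<lambda>x. \<Sum>k\<in>I. c k * w k x) x = (\<Sum>k\<in>I. c k * partial_deriv i (w k) x)"
    by (simp add: partial_deriv_frechet partial_deriv_frechet[OF W] cong: sum.cong)
qed

subsection \<open>Perturbations with compact support\<close>

text \<open>Only \<open>t = 0\<close> is critical, and there an exponent of at least 2 makes both
  one-sided derivatives 0. The shifted exponent lets \<open>n = 1\<close> and \<open>n = 0\<close>
  give the two successive derivatives of the cube of the positive part.\<close>

lemma has_real_derivative_pos_part_power:
  "((\<lambda>t. max 0 t ^ Suc (Suc n)) has_real_derivative real (Suc (Suc n)) * max 0 t ^ Suc n) (at t)"
proof -
  consider "t < 0" | "t = 0" | "t > 0" by linarith
  then show ?thesis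
  proof cases
    case 1
    have "((\<lambda>t. 0) has_real_derivative 0) (at t)" by simp
    then have "((\<lambda>t. max 0 t ^ Suc (Suc n)) has_real_derivative 0) (at t)"
      by (rule has_field_derivative_transform_within_open[of _ _ _ "{..<0}"]) (use 1 in auto)
    with 1 show ?thesis by simp
  next
    case 2
    have "(\<lambda>h::real. max 0 h ^ Suc n) \<midarrow>0\<rightarrow> max 0 0 ^ Suc n"
      by (intro tendsto_intros)
    then have "(\<lambda>h::real. max 0 h ^ Suc n) \<midarrow>0\<rightarrow> 0" by simp
    \<comment> \<open>The right-hand side is the difference quotient at 0: for \<open>h < 0\<close>
      both sides are 0, for \<open>h > 0\<close> one factor cancels.\<close>
    moreover have "\<forall>\<^sub>F h :: real in at 0. max 0 h ^ Suc n = max 0 h ^ Suc (Suc n) / h"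
      by (auto simp: eventually_at_filter max_def)
    ultimately have "(\<lambda>h::real. max 0 h ^ Suc (Suc n) / h) \<midarrow>0\<rightarrow> 0"
      by (rule Lim_transform_eventually)
    with 2 show ?thesis by (simp add: DERIV_def)
  next
    case 3
    have "((\<lambda>t. t ^ Suc (Suc n)) has_real_derivative real (Suc (Suc n)) * t ^ Suc n) (at t)"
      using DERIV_pow[of "Suc (Suc n)" t] by simp
    then have "((\<lambda>t. max 0 t ^ Suc (Suc n)) has_real_derivative real (Suc (Suc n)) * t ^ Suc n) (at t)"
      by (rule has_field_derivative_transform_within_open[of _ _ _ "{0<..}"]) (use 3 in auto)
    with 3 show ?thesis by simp
  qed
qed

text \<open>The cube is the lowest integer power of the positive part that is C2: its second
  derivative \<open>6 * max 0 t\<close> is still continuous.\<close>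

lemma C2_functions_pos_part_cube:
  assumes "f \<in> C2_functions"
  shows "(\<lambda>x. max 0 (f x) ^ 3) \<in> C2_functions"
proof (rule C2_functions_compose[OF assms])
  show "((\<lambda>t. max 0 t ^ 3) has_real_derivative 3 * max 0 t ^ 2) (at t)" for t :: real
    using has_real_derivative_pos_part_power[of 1 t] by (simp add: numeral_eq_Suc)
  show "((\<lambda>t. 3 * max 0 t ^ 2) has_real_derivative 3 * (2 * max 0 t)) (at t)" for t :: real
    using DERIV_cmult[OF has_real_derivative_pos_part_power[of 0 t], of 3]
    by (simp add: numeral_eq_Suc)
qed (intro continuous_intros)

lemma C2_bump_function:
  fixes r :: real
  assumes "r \<ge> 0"
  obtains \<phi> :: "real ^ 'n \<Rightarrow> real" where "\<phi> \<in> C2_functions"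
    "\<And>x. norm x \<le> r \<Longrightarrow> \<phi> x = 1" "\<And>x. norm x \<ge> r + 1 \<Longrightarrow> \<phi> x = 0"
proof
  \<comment> \<open>The inner expression is \<open>r\<^sup>2 + 1 - (norm x)\<^sup>2\<close>, spelled
    out as a polynomial in the coordinates so that the closure lemmas apply. Thus \<open>p\<close>
    is at least 1 on the ball of radius \<open>r\<close> and 0 far out.\<close>
  define p :: "real ^ 'n \<Rightarrow> real" where "p = (\<lambda>x. max 0 (r\<^sup>2 + 1 + (\<Sum>k\<in>UNIV. (- 1) * (x $ k * x $ k))) ^ 3)"
  \<comment> \<open>A second positive part flattens \<open>p\<close> to the constant 1 wherever
    \<open>p x \<ge> 1\<close>, and keeps the value 0 where \<open>p x = 0\<close>.\<close>
  define \<phi> where "\<phi> = (\<lambda>x. 1 + (- 1) * max 0 (1 + (- 1) * p x) ^ 3)"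
  have p_eq: "p x = max 0 (r\<^sup>2 + 1 - (norm x)\<^sup>2) ^ 3" for x
    unfolding power2_norm_eq_inner by (simp add: p_def inner_vec_def sum_negf)
  have "p \<in> C2_functions"
    unfolding p_def
    by (intro C2_functions_pos_part_cube C2_functions_add C2_functions_mult C2_functions_sum
        C2_functions_const C2_functions_nth)
  then show "\<phi> \<in> C2_functions"
    unfolding \<phi>_def
    by (intro C2_functions_pos_part_cube C2_functions_add C2_functions_mult C2_functions_const)
  show "\<phi> x = 1" if "norm x \<le> r" for x
  proof -
    have "(norm x)\<^sup>2 \<le> r\<^sup>2" using that by (simp add: power_mono)
    then have "p x \<ge> 1" unfolding p_eq by simp
    then show ?thesis by (simp add: \<phi>_def)
  qed
  show "\<phi> x = 0" if "norm x \<ge> r + 1" for x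
  proof -
    have "(norm x)\<^sup>2 \<ge> (r + 1)\<^sup>2" using that assms by (intro power_mono) auto
    also have "(r + 1)\<^sup>2 \<ge> r\<^sup>2 + 1" using assms by (simp add: power2_sum)
    finally have "p x = 0" by (simp add: p_eq)
    then show ?thesis by (simp add: \<phi>_def)
  qed
qed

text \<open>In the strong topology \<open>\<epsilon>\<close> may decay at infinity. The common
  compact support \<open>B\<close> avoids this: on \<open>B\<close> the function
  \<open>\<epsilon>\<close> is bounded below and all derivatives up to order two are bounded above,
  while off \<open>B\<close> nothing changes.\<close>

lemma small_lincomb_in_C2s_nbhd:
  fixes f :: "real ^ 'n \<Rightarrow> real" and w :: "'n \<Rightarrow> real ^ 'n \<Rightarrow> real"
  assumes f: "f \<in> C2_functions" and w: "\<And>k. w k \<in> C2_functions"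
    and B: "compact B" and supp: "\<And>k x. x \<notin> B \<Longrightarrow> w k x = 0"
    and \<epsilon>: "continuous_on UNIV \<epsilon>" "\<And>x. 0 < \<epsilon> x"
  shows "\<exists>\<delta>>0. \<forall>c. norm c < \<delta> \<longrightarrow> (\<lambda>x. f x + (\<Sum>k\<in>UNIV. c $ k * w k x)) \<in> C2s_nbhd f \<epsilon>"
proof -
  \<comment> \<open>The finitely many functions \<open>w k\<close> with their first and second
    partials, so that one bound \<open>M\<close> serves them all.\<close>
  define D where "D = range w \<union> (\<Union>k. range (\<lambda>i. partial_deriv i (w k))) \<union>
      (\<Union>k j. range (\<lambda>i. partial_deriv i (partial_deriv j (w k))))"
  have oB: "open (- B)" using B by (simp add: compact_imp_closed open_Compl)
  have supp1: "partial_deriv i (w k) x = 0" if "x \<notin> B" for i k x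
    by (rule partial_deriv_eq_0_open[OF oB]) (use that supp in auto)
  have supp2: "partial_deriv i (partial_deriv j (w k)) x = 0" if "x \<notin> B" for i j k x
    by (rule partial_deriv_eq_0_open[OF oB]) (use that supp1 in auto)
  have D0: "u x = 0" if "u \<in> D" "x \<notin> B" for u x
    using that supp supp1 supp2 unfolding D_def by auto
  have "bounded (u ` B)" if "u \<in> D" for u
  proof -
    have "continuous_on UNIV u"
      using that C2_functions_continuous[OF w] unfolding D_def by auto
    then show ?thesis
      using B by (meson compact_continuous_image compact_imp_bounded continuous_on_subset subset_UNIV)
  qed
  moreover have "finite D" by (simp add: D_def)
  ultimately have "bounded (\<Union>u\<in>D. u ` B)" by blast
  then obtain M where M: "M > 0" "\<And>u x. u \<in> D \<Longrightarrow> x \<in> B \<Longrightarrow> \<bar>u x\<bar> \<le> M"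
    unfolding bounded_pos by fastforce
  obtain e where e: "e > 0" "\<And>x. x \<in> B \<Longrightarrow> e \<le> \<epsilon> x"
  proof (cases "B = {}")
    case True
    then show ?thesis using that[of 1] by simp
  next
    case False
    then obtain y where "y \<in> B" "\<forall>x\<in>B. \<epsilon> y \<le> \<epsilon> x"
      using continuous_attains_inf[OF B] \<epsilon>(1) continuous_on_subset by blast
    then show ?thesis using that[of "\<epsilon> y"] \<epsilon>(2) by auto
  qed
  \<comment> \<open>Each of the \<open>CARD('n)\<close> summands is at most
    \<open>norm c * M\<close>, so \<open>norm c < \<delta>\<close> keeps the sum below
    \<open>e\<close>.\<close>
  define \<delta> where "\<delta> = e / (real CARD('n) * M)"
  have "\<delta> > 0" using e M by (simp add: \<delta>_def)
  moreover have "(\<lambda>x. f x + (\<Sum>k\<in>UNIV. c $ k * w k x)) \<in> C2s_nbhd f \<epsilon>" if c: "norm c < \<delta>" for c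
  proof -
    have small: "\<bar>\<Sum>k\<in>UNIV. c $ k * u k x\<bar> < \<epsilon> x" if u: "\<And>k. u k \<in> D" for u x
    proof (cases "x \<in> B")
      case True
      have "\<bar>\<Sum>k\<in>UNIV. c $ k * u k x\<bar> \<le> (\<Sum>k\<in>UNIV. \<bar>c $ k * u k x\<bar>)"
        by (rule sum_abs)
      also have "\<dots> \<le> (\<Sum>k\<in>(UNIV::'n set). norm c * M)"
        unfolding abs_mult using M u True component_le_norm_cart
        by (intro sum_mono mult_mono) auto
      also have "\<dots> < e"
        using c M by (simp add: \<delta>_def field_simps)
      finally show ?thesis using e True by force
    next
      case False
      with D0[OF u] \<epsilon>(2) show ?thesis by simp
    qed
    have lin: "partial_deriv i (\<lambda>x. \<Sum>k\<in>UNIV. c $ k * w k x) =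
          (\<lambda>x. \<Sum>k\<in>UNIV. c $ k * partial_deriv i (w k) x)"
        "partial_deriv i (\<lambda>x. \<Sum>k\<in>UNIV. c $ k * partial_deriv j (w k) x) =
          (\<lambda>x. \<Sum>k\<in>UNIV. c $ k * partial_deriv i (partial_deriv j (w k)) x)" for i j
      by (rule partial_deriv_lincomb, use w in \<open>blast intro: C2_functions_differentiable
          C1_functions_differentiable C2_functions_partial_deriv\<close>)+
    have "(\<lambda>x. f x + (\<Sum>k\<in>UNIV. c $ k * w k x)) \<in> C2_functions"
      by (intro C2_functions_add C2_functions_sum C2_functions_mult C2_functions_const f w)
    moreover have "\<bar>\<Sum>k\<in>UNIV. c $ k * w k x\<bar> < \<epsilon> x" for x
      by (rule small) (simp add: D_def)
    moreover have "\<bar>\<Sum>k\<in>UNIV. c $ k * partial_deriv i (w k) x\<bar> < \<epsilon> x" for i x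
      by (rule small) (auto simp: D_def)
    moreover have "\<bar>\<Sum>k\<in>UNIV. c $ k * partial_deriv i (partial_deriv j (w k)) x\<bar> < \<epsilon> x" for i j x
      by (rule small) (unfold D_def, rule UnI2, rule UN_I, rule UNIV_I, rule UN_I, rule UNIV_I, rule rangeI)
    ultimately show ?thesis
      by (simp add: C2s_nbhd_def lin)
  qed
  ultimately show ?thesis by blast
qed

subsection \<open>Absence of critical points\<close>

definition noncritical_on :: "(real ^ 'n) set \<Rightarrow> (real ^ 'n \<Rightarrow> real) set" where
  "noncritical_on A = {f \<in> C2_functions. \<forall>x\<in>A. \<exists>i. partial_deriv i f x \<noteq> 0}"

text \<open>At each point of \<open>A\<close> the largest partial of \<open>f\<close> in absolute
  value is nonzero, and a change smaller than that value cannot cancel it. Since the radius may vary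
  with the point, closedness of \<open>A\<close> suffices.\<close>

lemma C2s_open_noncritical_on:
  fixes A :: "(real ^ 'n) set"
  assumes A: "closed A"
  shows "C2s_open (noncritical_on A)"
\<comment> \<open>For empty \<open>A\<close> the convention makes \<open>infdist x A\<close> equal
  to 0, so the radius chosen below could vanish.\<close>
proof (cases "A = {}")
  case True
  then have "noncritical_on A = topspace C2s_topology" by (simp add: noncritical_on_def)
  then show ?thesis using openin_C2s_topology openin_topspace by metis
next
  case False
  show ?thesis
    unfolding C2s_open_def
  proof safe
    fix f :: "real ^ 'n \<Rightarrow> real" assume f: "f \<in> noncritical_on A"
    then show fC: "f \<in> C2_functions" by (simp add: noncritical_on_def)
    define m where "m = (\<lambda>x. Max ((\<lambda>i. \<bar>partial_deriv i f x\<bar>) ` UNIV))"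
    \<comment> \<open>The distance term is 0 on \<open>A\<close>, where \<open>m\<close> is the
      required bound, and makes the radius positive off \<open>A\<close>, where \<open>m\<close> may
      vanish.\<close>
    define \<epsilon> where "\<epsilon> = (\<lambda>x. m x + infdist x A)"
    have "continuous_on UNIV m"
      unfolding m_def using C2_functions_continuous(2)[OF fC]
      by (intro continuous_on_Max_finite continuous_on_rabs) auto
    then have "continuous_on UNIV \<epsilon>"
      unfolding \<epsilon>_def by (intro continuous_intros)
    moreover have mge: "\<bar>partial_deriv i f x\<bar> \<le> m x" for i x
      unfolding m_def by simp
    have "0 < \<epsilon> x" for x
    proof (cases "x \<in> A")
      case True
      then obtain i where "partial_deriv i f x \<noteq> 0"
        using f by (auto simp: noncritical_on_def)
      then have "0 < m x" using mge[of i x] by linarith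
      then show ?thesis by (simp add: \<epsilon>_def add_pos_nonneg infdist_nonneg)
    next
      case x: False
      then have "infdist x A > 0"
        using infdist_pos_not_in_closed[OF A False] by blast
      moreover have "0 \<le> m x" using mge abs_ge_zero order_trans by blast
      ultimately show ?thesis by (simp add: \<epsilon>_def)
    qed
    moreover have "C2s_nbhd f \<epsilon> \<subseteq> noncritical_on A"
    proof
      fix g assume g: "g \<in> C2s_nbhd f \<epsilon>"
      then have gC: "g \<in> C2_functions" by (simp add: C2s_nbhd_def)
      have "\<exists>i. partial_deriv i g x \<noteq> 0" if "x \<in> A" for x
      proof -
        have "m x \<in> (\<lambda>i. \<bar>partial_deriv i f x\<bar>) ` UNIV"
          unfolding m_def by (rule Max_in) auto
        then obtain i where i: "m x = \<bar>partial_deriv i f x\<bar>" by blast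
        have "\<bar>partial_deriv i (\<lambda>y. g y - f y) x\<bar> < \<epsilon> x"
          using g by (simp add: C2s_nbhd_def)
        then have "partial_deriv i g x \<noteq> 0"
          using i that by (auto simp: partial_deriv_diff_C2(1)[OF fC gC] \<epsilon>_def)
        then show ?thesis by blast
      qed
      with gC show "g \<in> noncritical_on A" by (simp add: noncritical_on_def)
    qed
    ultimately show "\<exists>\<epsilon>. continuous_on UNIV \<epsilon> \<and> (\<forall>x. 0 < \<epsilon> x) \<and> C2s_nbhd f \<epsilon> \<subseteq> noncritical_on A"
      by blast
  qed
qed

text \<open>A point \<open>x\<close> is critical for \<open>f\<close> plus the linear form with
  coefficients \<open>c\<close> exactly when \<open>c\<close> is the negative gradient of
  \<open>f\<close> at \<open>x\<close>. So it suffices to choose \<open>c\<close> small and outside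
  a negligible image; boundedness of \<open>A\<close> permits the cut-off.\<close>

lemma C2s_nbhd_meets_noncritical_on:
  fixes A :: "(real ^ 'n) set"
  assumes A: "bounded A" "negligible A" and f: "f \<in> C2_functions"
    and \<epsilon>: "continuous_on UNIV \<epsilon>" "\<And>x. 0 < \<epsilon> x"
  shows "C2s_nbhd f \<epsilon> \<inter> noncritical_on A \<noteq> {}"
proof -
  \<comment> \<open>The strict bound makes \<open>ball 0 r\<close> an open neighbourhood of every
    point of \<open>A\<close>, so that the cut-off is 1 near it and not only at it.\<close>
  obtain r where r: "r > 0" "\<And>x. x \<in> A \<Longrightarrow> norm x < r"
    using A(1) unfolding bounded_pos_less by blast
  obtain \<phi> :: "real ^ 'n \<Rightarrow> real" where \<phi>: "\<phi> \<in> C2_functions"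
    "\<And>x. norm x \<le> r \<Longrightarrow> \<phi> x = 1" "\<And>x. norm x \<ge> r + 1 \<Longrightarrow> \<phi> x = 0"
    using C2_bump_function[of r] r by auto
  define w where "w = (\<lambda>k x. \<phi> x * x $ k)"
  have w: "w k \<in> C2_functions" for k
    unfolding w_def by (intro C2_functions_mult \<phi> C2_functions_nth)
  have supp: "w k x = 0" if "x \<notin> cball 0 (r + 1)" for k x
    using \<phi>(3) that by (simp add: w_def)
  obtain \<delta> where \<delta>: "\<delta> > 0"
    "\<And>c. norm c < \<delta> \<Longrightarrow> (\<lambda>x. f x + (\<Sum>k\<in>UNIV. c $ k * w k x)) \<in> C2s_nbhd f \<epsilon>"
    using small_lincomb_in_C2s_nbhd[where f = f and w = w and B = "cball 0 (r + 1)" and \<epsilon> = \<epsilon>,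
        OF f w compact_cball supp \<epsilon>] by blast
  \<comment> \<open>The partials of \<open>f\<close> are differentiable, hence so is
    \<open>G\<close>, and a differentiable map between spaces of equal dimension sends negligible
    sets to negligible sets.\<close>
  define G where "G = (\<lambda>x. \<chi> i. - partial_deriv i f x)"
  have "G differentiable (at x)" for x
    unfolding differentiable_componentwise_within[of G]
    using C1_functions_differentiable[OF C2_functions_partial_deriv[OF f]]
    by (auto simp: G_def Basis_vec_def inner_axis)
  then have "G differentiable_on A"
    by (simp add: differentiable_on_def differentiable_at_withinI)
  then have "negligible (G ` A)"
    using A(2) by (intro negligible_differentiable_image_negligible) auto
  moreover have "\<not> negligible (ball (0 :: real ^ 'n) \<delta>)"
    using \<delta>(1) by (intro open_not_negligible) auto
  \<comment> \<open>A ball is not negligible, so arbitrarily small admissible \<open>c\<close>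
    exist.\<close>
  ultimately have "\<not> ball 0 \<delta> \<subseteq> G ` A"
    using negligible_subset by blast
  then obtain c where "c \<in> ball 0 \<delta>" "c \<notin> G ` A" by blast
  then have c: "norm c < \<delta>" "c \<notin> G ` A" by simp_all
  define g where "g = (\<lambda>x. f x + (\<Sum>k\<in>UNIV. c $ k * w k x))"
  have g: "g \<in> C2s_nbhd f \<epsilon>" unfolding g_def using c \<delta> by blast
  have "\<exists>i. partial_deriv i g x \<noteq> 0" if x: "x \<in> A" for x
  proof -
    have dw: "partial_deriv i (w k) x = (if i = k then 1 else 0)" for i k
    proof -
      have "partial_deriv i (w k) x = partial_deriv i (\<lambda>x. x $ k) x"
        by (rule partial_deriv_cong_open[of "ball 0 r"])
          (use r(2)[OF x] \<phi>(2) in \<open>auto simp: w_def C2_functions_differentiable C2_functions_nth\<close>)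
      then show ?thesis by (simp add: partial_deriv_nth)
    qed
    have "partial_deriv i g x = partial_deriv i f x + (\<Sum>k\<in>UNIV. c $ k * partial_deriv i (w k) x)" for i
      unfolding g_def using f w
      by (subst partial_deriv_add)
        (auto simp: partial_deriv_lincomb C2_functions_differentiable
          intro!: C2_functions_differentiable[OF C2_functions_sum] C2_functions_mult C2_functions_const)
    then have dg: "partial_deriv i g x = partial_deriv i f x + c $ i" for i
      by (simp add: dw if_distrib cong: if_cong)
    have "c \<noteq> G x" using c x by blast
    then obtain i where "c $ i \<noteq> - partial_deriv i f x"
      by (auto simp: G_def vec_eq_iff)
    then have "partial_deriv i g x \<noteq> 0"
      by (simp add: dg)
    then show ?thesis by blast
  qed
  with g show ?thesis
    by (auto simp: noncritical_on_def C2s_nbhd_def)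
qed

lemma dense_noncritical_on:
  fixes A :: "(real ^ 'n) set"
  assumes "bounded A" "negligible A"
  shows "C2s_topology closure_of (noncritical_on A) = topspace C2s_topology"
proof (intro equalityI closure_of_subset_topspace subsetI)
  fix f :: "real ^ 'n \<Rightarrow> real" assume f: "f \<in> topspace C2s_topology"
  have "\<exists>g. g \<in> noncritical_on A \<and> g \<in> T" if T: "f \<in> T" "C2s_open T" for T
  proof -
    obtain \<epsilon> where "continuous_on UNIV \<epsilon>" "\<forall>x. 0 < \<epsilon> x" "C2s_nbhd f \<epsilon> \<subseteq> T"
      using T unfolding C2s_open_def by blast
    then show ?thesis
      using C2s_nbhd_meets_noncritical_on[OF assms, of f \<epsilon>] f by auto
  qed
  with f show "f \<in> C2s_topology closure_of (noncritical_on A)"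
    by (simp add: in_closure_of)
qed

subsection \<open>Inactive local minimizers are critical points\<close>

text \<open>Changing one coordinate raises \<open>zero_norm\<close> by at most one, so the whole
  axis-parallel line through \<open>x\<close> is feasible and Fermat's rule applies to
  \<open>f\<close> on it.\<close>

lemma local_minimizer_inactive_critical:
  fixes f :: "real ^ 'n \<Rightarrow> real"
  assumes f: "f differentiable (at x)"
    and min: "local_minimizer_on f (sparse_vectors s) x" and s: "zero_norm x < s"
  shows "partial_deriv i f x = 0"
proof -
  obtain r where r: "r > 0" "\<forall>y\<in>sparse_vectors s \<inter> ball x r. f x \<le> f y"
    using min unfolding local_minimizer_on_def by blast
  have feas: "x + t *\<^sub>R axis i 1 \<in> sparse_vectors s" for t
  proof -
    have "zero_norm (x + t *\<^sub>R axis i 1) \<le> card (insert i {j. x $ j \<noteq> 0})"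
      unfolding zero_norm_def by (intro card_mono) (auto simp: axis_def)
    also have "\<dots> \<le> Suc (zero_norm x)"
      unfolding zero_norm_def by (simp add: card_insert_if)
    finally show ?thesis using s by (simp add: sparse_vectors_def)
  qed
  define h where "h = (\<lambda>t. f (x + t *\<^sub>R axis i 1))"
  have "h differentiable (at 0)"
    unfolding h_def using f
    by (intro differentiable_compose[where f = f and g = "\<lambda>t. x + t *\<^sub>R axis i 1"]) simp_all
  then have "(h has_real_derivative deriv h 0) (at 0)"
    using DERIV_deriv_iff_real_differentiable by blast
  moreover have "\<forall>t. \<bar>0 - t\<bar> < r \<longrightarrow> h 0 \<le> h t"
    using r(2) feas by (simp add: h_def dist_norm)
  ultimately have "deriv h 0 = 0"
    using r(1) DERIV_local_min by blast
  then show ?thesis by (simp add: partial_deriv_def h_def)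
qed

section \<open>The coordinate hyperplanes and the countable intersection\<close>

lemma coordinate_hyperplanes_Union: "{x :: real ^ 'n. \<exists>k. x $ k = 0} = (\<Union>k. {x. x $ k = 0})"
  by blast

lemma closed_coordinate_hyperplanes: "closed {x :: real ^ 'n. \<exists>k. x $ k = 0}"
proof -
  have "closed {x :: real ^ 'n. x $ k = 0}" for k
    by (rule closed_Collect_eq[OF continuous_on_component[OF continuous_on_id] continuous_on_const])
  then show ?thesis
    unfolding coordinate_hyperplanes_Union by (intro closed_UN) auto
qed

lemma negligible_coordinate_hyperplanes: "negligible {x :: real ^ 'n. \<exists>k. x $ k = 0}"
  unfolding coordinate_hyperplanes_Union
  by (rule negligible_Union) (auto intro: negligible_standard_hyperplane_cart)

theorem corollary1:
  fixes s :: nat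
  assumes "s < CARD('n::finite)"
  shows "C2s_generic {f :: real ^ 'n \<Rightarrow> real. f \<in> C2_functions \<and>
    (\<forall>x. local_minimizer_on f (sparse_vectors s) x \<longrightarrow> zero_norm x = s)}"
proof -
  \<comment> \<open>Truncation to balls gives the boundedness that the density argument uses; the
    countably many pieces together exhaust the hyperplanes.\<close>
  define K :: "nat \<Rightarrow> (real ^ 'n) set" where "K m = {x. \<exists>k. x $ k = 0} \<inter> cball 0 (real m)" for m
  have K: "closed (K m)" "bounded (K m)" "negligible (K m)" for m
    unfolding K_def using closed_coordinate_hyperplanes negligible_coordinate_hyperplanes
    by (auto intro: negligible_Int)
  have active: "zero_norm x = s"
    if f: "\<And>m. f \<in> noncritical_on (K m)" and x: "local_minimizer_on f (sparse_vectors s) x"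
    for f :: "real ^ 'n \<Rightarrow> real" and x
  proof (rule ccontr)
    assume "zero_norm x \<noteq> s"
    with x have lt: "zero_norm x < s"
      by (simp add: local_minimizer_on_def sparse_vectors_def)
    \<comment> \<open>This is where \<open>s < CARD('n)\<close> enters: a vector without zero
      entries would have \<open>zero_norm\<close> equal to the dimension.\<close>
    have "\<exists>k. x $ k = 0"
    proof (rule ccontr)
      assume "\<nexists>k. x $ k = 0"
      then have "zero_norm x = CARD('n)" by (simp add: zero_norm_def)
      with lt assms show False by simp
    qed
    then have "x \<in> K (nat \<lceil>norm x\<rceil>)"
      by (simp add: K_def real_nat_ceiling_ge)
    then obtain i where "partial_deriv i f x \<noteq> 0"
      using f unfolding noncritical_on_def by blast
    moreover have "f differentiable (at x)"
      using f[of 0] by (simp add: noncritical_on_def C2_functions_differentiable)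
    ultimately show False
      using local_minimizer_inactive_critical x lt by blast
  qed
  have "f \<in> C2_functions" if "\<And>m. f \<in> noncritical_on (K m)" for f
    using that by (simp add: noncritical_on_def)
  with active have "(\<Inter>m. noncritical_on (K m)) \<subseteq> {f. f \<in> C2_functions \<and>
      (\<forall>x. local_minimizer_on f (sparse_vectors s) x \<longrightarrow> zero_norm x = s)}"
    by blast
  moreover have "openin C2s_topology (noncritical_on (K m))"
    "C2s_topology closure_of noncritical_on (K m) = topspace C2s_topology" for m
    using C2s_open_noncritical_on[OF K(1)] dense_noncritical_on[OF K(2,3)] by simp_all
  ultimately show ?thesis
    unfolding C2s_generic_def by (intro conjI exI[of _ "\<lambda>m. noncritical_on (K m)"]) auto
qed

end
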